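(* (Refined chain rule, Bouligand derivative.) Let $X,Y,Z$ be normed spaces, $U\subset X$ and $V\subset Y$ open, and let $F_1:U\to Y$, $F_2:V\to Z$ be locally Lipschitz with $F_1(U)\subset V$. Let $\tilde X,\tilde Y$ be normed spaces with continuous embeddings $X\subset\tilde X$, $Y\subset\tilde Y$. Assume that $F_1$ and $F_2$ are Bouligand differentiable in $U$ and $V$, respectively, and that for every $u\in U$, $v\in V$ $$\|F_1(u+h)-F_1(u)-F_1'(u;h)\|_Y\le\rho_{1,u}(\|h\|_{\tilde X})\,\|h\|_X,\qquad\|F_2(v+k)-F_2(v)-F_2'(v;k)\|_Z\le\rho_{2,v}(\|k\|_{\tilde Y})\,\|k\|_Y$$ for every $h\in X$ with $u+h\in U$ and every $k\in Y$ with $v+k\in V$, with functions $\rho_{1,u},\rho_{2,v}:\mathbb{R}_+\to\mathbb{R}_+$ satisfying $\rho_{1,u}(\delta)\downarrow0$ and $\rho_{2,v}(\delta)\downarrow0$ as $\delta\downarrow0$. Assume that $F_1:(U,\|\cdot\|_{\tilde X})\to(V,\|\cdot\|_{\tilde Y})$ is continuous. Then $F=F_2\circ F_1$ is Bouligand differentiable in $U$, and $$F'(u;h)=F_2'(F_1(u);F_1'(u;h)).$$ Moreover, for every $u\in U$ and $h\in X$ with $u+h\in U$, $$\|F(u+h)-F(u)-F_2'(F_1(u);F_1'(u;h))\|_Z\le\rho_u(\|h\|_{\tilde X})\,\|h\|_X$$ for some $\rho_u:\mathbb{R}_+\to\mathbb{R}_+$ with $\rho_u(\delta)\downarrow0$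 as $\delta\downarrow0$.
   Context: $F:U\to B$ ($A,B$ normed spaces, $U\subset A$ open) is Bouligand differentiable at $u\in U$ if the directional derivative $F'(u;h)=\lim_{\lambda\downarrow0}(F(u+\lambda h)-F(u))/\lambda$ exists in $B$ for all $h\in A$ and $\lim_{h\to0}\|F(u+h)-F(u)-F'(u;h)\|/\|h\|=0$; it is Bouligand differentiable in $U$ if this holds at every $u\in U$. The function $\rho_u$ may depend on $u$ but not on $h$.
   Formalization: The last estimate fails for large h with a finite ρ_u; it is proved for u+h in U with ‖h‖ in X~ below some r>0 depending on u, and for every h with u+h in U if F_1 maps X~-bounded subsets of U to Y~-bounded sets. *)

theory Defs
  imports "HOL-Analysis.Analysis"
begin

text \<open>
  A map on an open set is a total function; the notions below only see its values near points of
  the set.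
\<close>

definition has_dir_deriv ::
    "('a::real_normed_vector \<Rightarrow> 'b::real_normed_vector) \<Rightarrow> 'a \<Rightarrow> 'a \<Rightarrow> 'b \<Rightarrow> bool" where
  "has_dir_deriv F u h d \<longleftrightarrow> ((\<lambda>t. (F (u + t *\<^sub>R h) - F u) /\<^sub>R t) \<longlongrightarrow> d) (at_right (0::real))"

definition dir_deriv ::
    "('a::real_normed_vector \<Rightarrow> 'b::real_normed_vector) \<Rightarrow> 'a \<Rightarrow> 'a \<Rightarrow> 'b" where
  "dir_deriv F u h = (THE d. has_dir_deriv F u h d)"

definition bouligand_differentiable_at ::
    "('a::real_normed_vector \<Rightarrow> 'b::real_normed_vector) \<Rightarrow> 'a \<Rightarrow> bool" where
  "bouligand_differentiable_at F u \<longleftrightarrow>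
     (\<forall>h. \<exists>d. has_dir_deriv F u h d) \<and>
     ((\<lambda>h. norm (F (u + h) - F u - dir_deriv F u h) / norm h) \<longlongrightarrow> 0) (at 0)"

definition bouligand_differentiable_on ::
    "('a::real_normed_vector \<Rightarrow> 'b::real_normed_vector) \<Rightarrow> 'a set \<Rightarrow> bool" where
  "bouligand_differentiable_on F U \<longleftrightarrow> (\<forall>u\<in>U. bouligand_differentiable_at F u)"

definition locally_lipschitz_on ::
    "'a::metric_space set \<Rightarrow> ('a \<Rightarrow> 'b::metric_space) \<Rightarrow> bool" where
  "locally_lipschitz_on U F \<longleftrightarrow> (\<forall>u\<in>U. \<exists>r>0. \<exists>L. L-lipschitz_on (U \<inter> ball u r) F)"

text \<open>
  A continuous embedding of normed spaces is an explicit map \<open>j\<close>; the weaker norm of \<open>h\<close> is then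
  \<open>norm (j h)\<close>.
\<close>

definition continuous_embedding ::
    "('a::real_normed_vector \<Rightarrow> 'b::real_normed_vector) \<Rightarrow> bool" where
  "continuous_embedding j \<longleftrightarrow> bounded_linear j \<and> inj j"

text \<open>
  A function from the nonnegative reals to themselves that decreases to 0 as its argument
  decreases to 0; values at negative arguments are irrelevant.
\<close>

definition decreases_to_zero :: "(real \<Rightarrow> real) \<Rightarrow> bool" where
  "decreases_to_zero \<rho> \<longleftrightarrow>
     (\<forall>\<delta>\<ge>0. 0 \<le> \<rho> \<delta>) \<and> mono_on {0..} \<rho> \<and> (\<rho> \<longlongrightarrow> 0) (at_right 0)"

text \<open>
  In the refined chain rule the remainder estimate for the composition is unconditional for
  increments \<open>h\<close> that are small in the weaker norm, and holds for all increments if \<open>F1\<close> maps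
  bounded sets to bounded sets with respect to the weaker norms.  A finite-valued modulus for all
  increments is not available in general.  Let \<open>X = l^1\<close>, embedded into \<open>l^\<infinity>\<close>, let \<open>Y\<close>, its weaker
  space and \<open>Z\<close> be the reals, let \<open>\<phi>\<close> be smooth with bounded first and second derivatives,
  vanishing on \<open>[-1/2, 1/2]\<close>, with \<open>\<phi> 1 = 1\<close>, and put \<open>F1 x = (\<Sum>i. \<phi> (x i))\<close>, \<open>F2 y = y^4\<close>.
  For the sequence \<open>h\<close> consisting of \<open>n\<close> ones followed by zeros and \<open>u = 0\<close>, the remainder of
  the composition is \<open>n^4\<close>, while the strong norm of \<open>h\<close> is \<open>n\<close> and the weak norm is \<open>1\<close>.
\<close>

end

theory Submission imports Defs begin

text \<open>
  Put \<open>k = F1 (u + h) - F1 u\<close>.  The remainder of the composition splits into the remainder of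
  \<open>F2\<close> at \<open>F1 u\<close> for the increment \<open>k\<close> and the difference of \<open>F2' (F1 u; _)\<close> at \<open>k\<close> and at
  \<open>F1' (u; h)\<close>.  Directional derivatives of a locally Lipschitz map are globally Lipschitz in the
  direction, so the second part is controlled by the remainder of \<open>F1\<close>, and the strong norm of \<open>k\<close>
  is controlled by that of \<open>h\<close>.  The weak norm of \<open>k\<close> is dominated by a modulus of continuity of
  \<open>F1\<close> at \<open>u\<close>, which is finite whenever the weak norms of the increments \<open>k\<close> are bounded.
  Differentiability of the composition is read off from the remainder estimate.
\<close>

section \<open>Directional derivatives\<close>

lemma has_dir_deriv_unique:
  "has_dir_deriv F u h d \<Longrightarrow> has_dir_deriv F u h e \<Longrightarrow> d = e"
  unfolding has_dir_deriv_def by (rule tendsto_unique) (auto simp: trivial_limit_at_right_real)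

lemma dir_deriv_eqI: "has_dir_deriv F u h d \<Longrightarrow> dir_deriv F u h = d"
  unfolding dir_deriv_def by (blast intro: has_dir_deriv_unique)

lemma bouligand_has_dir_deriv:
  assumes "bouligand_differentiable_at F u"
  shows "has_dir_deriv F u h (dir_deriv F u h)"
  using assms dir_deriv_eqI unfolding bouligand_differentiable_at_def by metis

lemma has_dir_deriv_zero: "has_dir_deriv F u 0 0"
  by (simp add: has_dir_deriv_def)

text \<open>For positive \<open>c\<close> the substitution of \<open>c * t\<close> for
  \<open>t\<close> preserves the one-sided limit at 0, and the quotient picks up the factor
  \<open>c\<close>. At \<open>c = 0\<close> the substitution degenerates, so that case is separate.
  Negative \<open>c\<close> would reverse the side of approach.\<close>

lemma has_dir_deriv_scale:
  assumes "has_dir_deriv F u h d" and "c \<ge> 0"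
  shows "has_dir_deriv F u (c *\<^sub>R h) (c *\<^sub>R d)"
proof (cases "c = 0")
  case True
  then show ?thesis by (simp add: has_dir_deriv_zero)
next
  case False
  with assms have c: "c > 0" by simp
  have "filterlim (\<lambda>t. c * t) (at_right 0) (at_right (0::real))"
    unfolding filterlim_at using c
    by (auto intro!: tendsto_eq_intros simp: eventually_at_filter)
  from filterlim_compose[OF assms(1)[unfolded has_dir_deriv_def] this]
  have "((\<lambda>t. c *\<^sub>R ((F (u + (c * t) *\<^sub>R h) - F u) /\<^sub>R (c * t))) \<longlongrightarrow> c *\<^sub>R d) (at_right 0)"
    by (intro tendsto_intros)
  moreover have "c * (inverse t * inverse c) = inverse t" for t
    using c by simp
  ultimately show ?thesis
    by (simp add: has_dir_deriv_def mult.commute)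
qed

lemma dir_deriv_scale:
  assumes "bouligand_differentiable_at F u" and "c \<ge> 0"
  shows "dir_deriv F u (c *\<^sub>R h) = c *\<^sub>R dir_deriv F u h"
  by (intro dir_deriv_eqI has_dir_deriv_scale bouligand_has_dir_deriv assms)

text \<open>For the same small \<open>t\<close>, the difference quotients in two directions differ
  by at most \<open>L * norm (h - k)\<close>, where \<open>L\<close> is the Lipschitz constant of
  \<open>F\<close> near \<open>u\<close>, and the limit keeps this bound. Directions may be
  arbitrarily large because \<open>t\<close> shrinks after they are fixed, so a local constant gives
  a global one.\<close>

lemma has_dir_deriv_lipschitz:
  assumes "locally_lipschitz_on U F" and "open U" and "u \<in> U"
  shows "\<exists>L\<ge>0. \<forall>h k d e. has_dir_deriv F u h d \<longrightarrow> has_dir_deriv F u k e \<longrightarrow>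
           norm (d - e) \<le> L * norm (h - k)"
proof -
  obtain r L where r: "r > 0" and L: "L-lipschitz_on (U \<inter> ball u r) F"
    using assms unfolding locally_lipschitz_on_def by blast
  let ?W = "U \<inter> ball u r"
  have W: "open ?W" "u \<in> ?W" using assms r by auto
  have "norm (d - e) \<le> L * norm (h - k)"
    if d: "has_dir_deriv F u h d" and e: "has_dir_deriv F u k e" for h k d e
  proof (rule tendsto_upperbound)
    show "((\<lambda>t. norm ((F (u + t *\<^sub>R h) - F u) /\<^sub>R t - (F (u + t *\<^sub>R k) - F u) /\<^sub>R t))
            \<longlongrightarrow> norm (d - e)) (at_right 0)"
      using d e unfolding has_dir_deriv_def by (intro tendsto_intros)
    \<comment> \<open>Every ray from \<open>u\<close> starts inside the neighbourhood on which the
      Lipschitz estimate is available.\<close>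
    have ev: "\<forall>\<^sub>F t in at_right 0. u + t *\<^sub>R x \<in> ?W" for x
    proof -
      have "((\<lambda>t. u + t *\<^sub>R x) \<longlongrightarrow> u) (at_right 0)"
        by (auto intro!: tendsto_eq_intros)
      then show ?thesis using W by (rule topological_tendstoD)
    qed
    show "\<forall>\<^sub>F t in at_right 0.
        norm ((F (u + t *\<^sub>R h) - F u) /\<^sub>R t - (F (u + t *\<^sub>R k) - F u) /\<^sub>R t) \<le> L * norm (h - k)"
      using ev[of h] ev[of k] eventually_at_right_less[of 0]
    proof eventually_elim
      case (elim t)
      have "norm (F (u + t *\<^sub>R h) - F (u + t *\<^sub>R k)) \<le> L * norm (t *\<^sub>R (h - k))"
        using lipschitz_onD[OF L elim(1,2)] by (simp add: dist_norm algebra_simps)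
      then have "norm ((F (u + t *\<^sub>R h) - F (u + t *\<^sub>R k)) /\<^sub>R t) \<le> L * norm (h - k)"
        using elim(3) by (simp add: pos_divide_le_eq divide_inverse_commute[symmetric] algebra_simps
            del: scaleR_diff_right)
      then show ?case by (simp flip: scaleR_diff_right)
    qed
  qed (simp add: trivial_limit_at_right_real)
  then show ?thesis using lipschitz_on_nonneg[OF L] by blast
qed

text \<open>On a ray \<open>t *\<^sub>R h\<close>, homogeneity turns the remainder divided by
  \<open>t\<close> into the difference quotient minus \<open>B h\<close>. A first-order remainder
  estimate for a positively homogeneous candidate therefore already yields the directional
  derivatives and identifies them with \<open>B\<close>.\<close>

lemma
  assumes hom: "\<And>c h. c \<ge> 0 \<Longrightarrow> B (c *\<^sub>R h) = c *\<^sub>R B h"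
    and lim: "((\<lambda>h. norm (F (u + h) - F u - B h) / norm h) \<longlongrightarrow> 0) (at 0)"
  shows bouligand_differentiable_atI: "bouligand_differentiable_at F u"
    and dir_deriv_eq_homogeneous: "dir_deriv F u h = B h"
proof -
  have B: "has_dir_deriv F u h (B h)" for h
  \<comment> \<open>The limit at 0 ignores the point 0 itself, so the constant ray is excluded;
    there homogeneity with factor 0 gives \<open>B 0 = 0\<close>.\<close>
  proof (cases "h = 0")
    case True
    then show ?thesis using hom[of 0 0] by (simp add: has_dir_deriv_zero)
  next
    case False
    have "filterlim (\<lambda>t. t *\<^sub>R h) (at 0) (at_right (0::real))"
      unfolding filterlim_at using False
      by (auto intro!: tendsto_eq_intros simp: eventually_at_filter)
    from filterlim_compose[OF lim this]
    \<comment> \<open>The factor \<open>norm h\<close> changes the divisor from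
      \<open>norm (t *\<^sub>R h)\<close> to \<open>t\<close>.\<close>
    have "((\<lambda>t. norm (F (u + t *\<^sub>R h) - F u - B (t *\<^sub>R h)) / norm (t *\<^sub>R h) * norm h)
            \<longlongrightarrow> 0) (at_right 0)"
      by (rule tendsto_mult_left_zero)
    moreover have "\<forall>\<^sub>F t in at_right 0.
        norm (F (u + t *\<^sub>R h) - F u - B (t *\<^sub>R h)) / norm (t *\<^sub>R h) * norm h
          = norm ((F (u + t *\<^sub>R h) - F u) /\<^sub>R t - B h)"
      using eventually_at_right_less[of 0]
    proof eventually_elim
      case (elim t)
      have "(F (u + t *\<^sub>R h) - F u) /\<^sub>R t - B h = (F (u + t *\<^sub>R h) - F u - B (t *\<^sub>R h)) /\<^sub>R t"
        using elim by (simp add: hom scaleR_diff_right)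
      then show ?case using elim False by (simp add: divide_inverse mult.commute)
    qed
    ultimately have "((\<lambda>t. norm ((F (u + t *\<^sub>R h) - F u) /\<^sub>R t - B h)) \<longlongrightarrow> 0) (at_right 0)"
      by (rule Lim_transform_eventually)
    then have "((\<lambda>t. (F (u + t *\<^sub>R h) - F u) /\<^sub>R t - B h) \<longlongrightarrow> 0) (at_right 0)"
      by (rule tendsto_norm_zero_cancel)
    then show ?thesis
      unfolding has_dir_deriv_def by (rule LIM_zero_cancel)
  qed
  show "dir_deriv F u h = B h" for h
    by (rule dir_deriv_eqI[OF B])
  then show "bouligand_differentiable_at F u"
    unfolding bouligand_differentiable_at_def using B lim by auto
qed

section \<open>Moduli\<close>

lemma decreases_to_zero_nonneg: "decreases_to_zero \<rho> \<Longrightarrow> \<delta> \<ge> 0 \<Longrightarrow> \<rho> \<delta> \<ge> 0"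
  by (simp add: decreases_to_zero_def)

lemma decreases_to_zero_mono:
  "decreases_to_zero \<rho> \<Longrightarrow> 0 \<le> \<delta> \<Longrightarrow> \<delta> \<le> \<epsilon> \<Longrightarrow> \<rho> \<delta> \<le> \<rho> \<epsilon>"
  unfolding decreases_to_zero_def by (elim conjE, erule mono_onD) auto

lemma decreases_to_zero_tendsto: "decreases_to_zero \<rho> \<Longrightarrow> (\<rho> \<longlongrightarrow> 0) (at_right 0)"
  by (simp add: decreases_to_zero_def)

lemma decreases_to_zero_small:
  assumes "decreases_to_zero \<rho>" and "e > 0"
  obtains d where "d > 0" and "\<rho> d < e"
proof -
  have "\<forall>\<^sub>F \<delta> in at_right 0. \<rho> \<delta> < e"
    using decreases_to_zero_tendsto[OF assms(1)] assms(2) by (rule order_tendstoD)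
  then have "\<forall>\<^sub>F \<delta> in at_right 0. 0 < \<delta> \<and> \<rho> \<delta> < e"
    using eventually_at_right_less[of 0] by eventually_elim simp
  then obtain d where "0 < d" "\<rho> d < e"
    using eventually_happens[of _ "at_right (0::real)"] trivial_limit_at_right_real[of 0] by blast
  then show ?thesis using that by blast
qed

text \<open>By monotonicity and nonnegativity, a single small value at some \<open>d > 0\<close>
  controls all values on the interval from 0 to \<open>d\<close>, so no separate limit argument is
  needed.\<close>

lemma decreases_to_zeroI:
  assumes "\<And>\<delta>. \<delta> \<ge> 0 \<Longrightarrow> \<rho> \<delta> \<ge> 0"
    and "\<And>\<delta> \<epsilon>. 0 \<le> \<delta> \<Longrightarrow> \<delta> \<le> \<epsilon> \<Longrightarrow> \<rho> \<delta> \<le> \<rho> \<epsilon>"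
    and small: "\<And>e. e > 0 \<Longrightarrow> \<exists>d>0. \<rho> d < e"
  shows "decreases_to_zero \<rho>"
  unfolding decreases_to_zero_def
proof (intro conjI allI impI mono_onI)
  show "(\<rho> \<longlongrightarrow> 0) (at_right 0)"
  proof (rule tendstoI)
    fix e :: real assume "e > 0"
    then obtain d where "d > 0" "\<rho> d < e" using small by blast
    then have "dist (\<rho> \<delta>) 0 < e" if "0 < \<delta>" "\<delta> < d" for \<delta>
      using assms(1)[of \<delta>] assms(2)[of \<delta> d] that by auto
    then show "\<forall>\<^sub>F \<delta> in at_right 0. dist (\<rho> \<delta>) 0 < e"
      using \<open>d > 0\<close> by (auto simp: eventually_at_right_field)
  qed
qed (use assms in auto)

lemma decreases_to_zero_add:
  assumes "decreases_to_zero \<rho>" and "decreases_to_zero \<sigma>"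
  shows "decreases_to_zero (\<lambda>\<delta>. \<rho> \<delta> + \<sigma> \<delta>)"
  unfolding decreases_to_zero_def
proof (intro conjI allI impI mono_onI)
  show "((\<lambda>\<delta>. \<rho> \<delta> + \<sigma> \<delta>) \<longlongrightarrow> 0) (at_right 0)"
    by (intro tendsto_add_zero decreases_to_zero_tendsto assms)
qed (auto intro: add_mono add_nonneg_nonneg
    decreases_to_zero_mono[OF assms(1)] decreases_to_zero_mono[OF assms(2)]
    decreases_to_zero_nonneg[OF assms(1)] decreases_to_zero_nonneg[OF assms(2)])

lemma decreases_to_zero_mult:
  assumes "decreases_to_zero \<rho>" and "decreases_to_zero \<sigma>"
  shows "decreases_to_zero (\<lambda>\<delta>. \<rho> \<delta> * \<sigma> \<delta>)"
  unfolding decreases_to_zero_def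
proof (intro conjI allI impI mono_onI)
  show "((\<lambda>\<delta>. \<rho> \<delta> * \<sigma> \<delta>) \<longlongrightarrow> 0) (at_right 0)"
    by (intro tendsto_mult_zero decreases_to_zero_tendsto assms)
qed (auto intro!: mult_mono mult_nonneg_nonneg
    decreases_to_zero_mono[OF assms(1)] decreases_to_zero_mono[OF assms(2)]
    decreases_to_zero_nonneg[OF assms(1)] decreases_to_zero_nonneg[OF assms(2)])

lemma decreases_to_zero_cmult:
  assumes "decreases_to_zero \<rho>" and "c \<ge> 0"
  shows "decreases_to_zero (\<lambda>\<delta>. c * \<rho> \<delta>)"
  unfolding decreases_to_zero_def
proof (intro conjI allI impI mono_onI)
  show "((\<lambda>\<delta>. c * \<rho> \<delta>) \<longlongrightarrow> 0) (at_right 0)"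
    by (intro tendsto_mult_right_zero decreases_to_zero_tendsto assms)
qed (use assms(2) in \<open>auto intro: mult_left_mono mult_nonneg_nonneg
    decreases_to_zero_mono[OF assms(1)] decreases_to_zero_nonneg[OF assms(1)]\<close>)

text \<open>Composing the limits directly would fail, since \<open>\<omega>\<close> may vanish at
  positive arguments while the limit of \<open>\<rho>\<close> at the right of 0 ignores
  \<open>\<rho> 0\<close>. Monotonicity of \<open>\<rho>\<close> covers that value as well.\<close>

lemma decreases_to_zero_compose:
  assumes \<rho>: "decreases_to_zero \<rho>" and \<omega>: "decreases_to_zero \<omega>"
  shows "decreases_to_zero (\<lambda>\<delta>. \<rho> (\<omega> \<delta>))"
proof (rule decreases_to_zeroI)
  fix e :: real assume "e > 0"
  then obtain d where d: "d > 0" "\<rho> d < e" by (rule decreases_to_zero_small[OF \<rho>])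
  then obtain d' where d': "d' > 0" "\<omega> d' < d" by (blast intro: decreases_to_zero_small[OF \<omega>])
  have "\<rho> (\<omega> d') \<le> \<rho> d"
    using d d' by (intro decreases_to_zero_mono[OF \<rho>] decreases_to_zero_nonneg[OF \<omega>]) auto
  then show "\<exists>d>0. \<rho> (\<omega> d) < e" using d d' by force
qed (simp_all add: decreases_to_zero_mono[OF \<rho>] decreases_to_zero_mono[OF \<omega>]
    decreases_to_zero_nonneg[OF \<rho>] decreases_to_zero_nonneg[OF \<omega>])

text \<open>The modulus at \<open>D\<close> is the supremum of \<open>q\<close> over the sublevel
  set of \<open>p\<close> at \<open>D\<close>; enlarging \<open>D\<close> enlarges the set. The
  bound on each sublevel set makes the supremum finite.\<close>

lemma modulus_exists:
  fixes p q :: "'a \<Rightarrow> real"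
  assumes small: "\<And>e. e > 0 \<Longrightarrow> \<exists>d>0. \<forall>a\<in>A. p a < d \<longrightarrow> q a < e"
    and bdd: "\<And>D. bdd_above (q ` {a \<in> A. p a \<le> D})"
  obtains \<omega> where "decreases_to_zero \<omega>" and "\<And>a. a \<in> A \<Longrightarrow> q a \<le> \<omega> (p a)"
proof
  \<comment> \<open>Inserting 0 keeps the set nonempty and its supremum nonnegative.\<close>
  let ?S = "\<lambda>D. insert 0 (q ` {a \<in> A. p a \<le> D})"
  have S: "bdd_above (?S D)" for D using bdd by simp
  show "decreases_to_zero (\<lambda>D. Sup (?S D))"
  proof (rule decreases_to_zeroI)
    show "0 \<le> Sup (?S \<delta>)" for \<delta> by (rule cSup_upper[OF _ S]) simp
    show "Sup (?S \<delta>) \<le> Sup (?S \<epsilon>)" if "\<delta> \<le> \<epsilon>" for \<delta> \<epsilon>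
      by (rule cSup_subset_mono[OF _ S]) (use that in auto)
    fix e :: real assume "e > 0"
    \<comment> \<open>Halving \<open>e\<close> leaves room for the supremum to attain its bound;
      halving \<open>d\<close> below passes from the closed sublevel set to the strict
      inequality.\<close>
    then obtain d where d: "d > 0" "\<And>a. a \<in> A \<Longrightarrow> p a < d \<Longrightarrow> q a < e / 2"
      using small[of "e / 2"] by auto
    have "q a \<le> e / 2" if "a \<in> A" "p a \<le> d / 2" for a
      using d(2)[OF that(1)] that(2) d(1) by simp
    then have "Sup (?S (d / 2)) \<le> e / 2" using \<open>e > 0\<close> by (intro cSup_least) auto
    then show "\<exists>d>0. Sup (?S d) < e" using d(1) \<open>e > 0\<close> by (intro exI[of _ "d / 2"]) auto
  qed
  show "q a \<le> Sup (?S (p a))" if "a \<in> A" for a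
    by (rule cSup_upper[OF _ S]) (use that in auto)
qed

section \<open>The chain rule\<close>

text \<open>A type carries only one norm, so continuity of \<open>F1\<close> between the weaker
  norms is expressed on the image of \<open>U\<close> under \<open>jX\<close>, with
  \<open>inv jX\<close> leading back to \<open>U\<close>.\<close>

theorem proposition5p4:
  fixes U :: "'x::real_normed_vector set" and V :: "'y::real_normed_vector set"
    and F1 :: "'x \<Rightarrow> 'y" and F2 :: "'y \<Rightarrow> 'z::real_normed_vector"
    and jX :: "'x \<Rightarrow> 'xt::real_normed_vector" and jY :: "'y \<Rightarrow> 'yt::real_normed_vector"
    and \<rho>1 :: "'x \<Rightarrow> real \<Rightarrow> real" and \<rho>2 :: "'y \<Rightarrow> real \<Rightarrow> real"
  assumes "open U" and "open V"
    and "locally_lipschitz_on U F1" and "locally_lipschitz_on V F2"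
    and "F1 ` U \<subseteq> V"
    and "continuous_embedding jX" and "continuous_embedding jY"
    and "bouligand_differentiable_on F1 U" and "bouligand_differentiable_on F2 V"
    and "\<And>u. u \<in> U \<Longrightarrow> decreases_to_zero (\<rho>1 u)"
    and "\<And>v. v \<in> V \<Longrightarrow> decreases_to_zero (\<rho>2 v)"
    and "\<And>u h. u \<in> U \<Longrightarrow> u + h \<in> U \<Longrightarrow>
           norm (F1 (u + h) - F1 u - dir_deriv F1 u h) \<le> \<rho>1 u (norm (jX h)) * norm h"
    and "\<And>v k. v \<in> V \<Longrightarrow> v + k \<in> V \<Longrightarrow>
           norm (F2 (v + k) - F2 v - dir_deriv F2 v k) \<le> \<rho>2 v (norm (jY k)) * norm k"
    and "continuous_on (jX ` U) (jY \<circ> F1 \<circ> inv jX)"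
  shows "bouligand_differentiable_on (F2 \<circ> F1) U
    \<and> (\<forall>u\<in>U. \<forall>h. dir_deriv (F2 \<circ> F1) u h = dir_deriv F2 (F1 u) (dir_deriv F1 u h))
    \<and> (\<forall>u\<in>U. \<exists>\<rho> r. decreases_to_zero \<rho> \<and> r > 0 \<and>
         (\<forall>h. u + h \<in> U \<longrightarrow> norm (jX h) < r \<longrightarrow>
            norm ((F2 \<circ> F1) (u + h) - (F2 \<circ> F1) u - dir_deriv F2 (F1 u) (dir_deriv F1 u h))
              \<le> \<rho> (norm (jX h)) * norm h))
    \<and> ((\<forall>S\<subseteq>U. bounded (jX ` S) \<longrightarrow> bounded (jY ` F1 ` S)) \<longrightarrow>
        (\<forall>u\<in>U. \<exists>\<rho>. decreases_to_zero \<rho> \<and>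
          (\<forall>h. u + h \<in> U \<longrightarrow>
            norm ((F2 \<circ> F1) (u + h) - (F2 \<circ> F1) u - dir_deriv F2 (F1 u) (dir_deriv F1 u h))
              \<le> \<rho> (norm (jX h)) * norm h)))"
proof -
  interpret jX: bounded_linear jX
    using assms(6) by (simp add: continuous_embedding_def)
  interpret jY: bounded_linear jY
    using assms(7) by (simp add: continuous_embedding_def)
  have inj: "inj jX" using assms(6) by (simp add: continuous_embedding_def)
  have D1: "bouligand_differentiable_at F1 u" if "u \<in> U" for u
    using assms(8) that by (simp add: bouligand_differentiable_on_def)
  have D2: "bouligand_differentiable_at F2 v" if "v \<in> V" for v
    using assms(9) that by (simp add: bouligand_differentiable_on_def)
  have V: "F1 u \<in> V" if "u \<in> U" for u using assms(5) that by blast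

  define k where "k u h = F1 (u + h) - F1 u" for u h
  define B where "B u h = dir_deriv F2 (F1 u) (dir_deriv F1 u h)" for u h
  define R where "R u h = (F2 \<circ> F1) (u + h) - (F2 \<circ> F1) u - B u h" for u h

  \<comment> \<open>Weak continuity restated for increments: injectivity of \<open>jX\<close>
    cancels \<open>inv jX\<close>, and linearity of both embeddings turns distances into norms of
    increments.\<close>
  have cont: "\<exists>d>0. \<forall>h. u + h \<in> U \<longrightarrow> norm (jX h) < d \<longrightarrow> norm (jY (k u h)) < e"
    if u: "u \<in> U" and e: "e > 0" for u e
  proof -
    obtain d where "d > 0" and d: "\<And>x. x \<in> jX ` U \<Longrightarrow> dist x (jX u) < d \<Longrightarrow>
        dist ((jY \<circ> F1 \<circ> inv jX) x) ((jY \<circ> F1 \<circ> inv jX) (jX u)) < e"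
      using assms(14) u e unfolding continuous_on_iff by blast
    have "norm (jY (k u h)) < e" if "u + h \<in> U" "norm (jX h) < d" for h
      using d[of "jX (u + h)"] that
      by (simp add: inv_f_f[OF inj] dist_norm k_def jY.diff flip: jX.diff)
    then show ?thesis using \<open>d > 0\<close> by blast
  qed

  \<comment> \<open>The set \<open>A\<close> of admissible increments is left open so that one
    argument serves both estimates: \<open>A\<close> is later a small weak ball, where
    \<open>bdd\<close> is automatic, or all increments, where it comes from the boundedness
    hypothesis.\<close>
  have core: "\<exists>\<rho>. decreases_to_zero \<rho> \<and> (\<forall>h\<in>A. norm (R u h) \<le> \<rho> (norm (jX h)) * norm h)"
    if u: "u \<in> U" and A: "\<And>h. h \<in> A \<Longrightarrow> u + h \<in> U"
      and bdd: "\<And>D. bdd_above ((\<lambda>h. norm (jY (k u h))) ` {h \<in> A. norm (jX h) \<le> D})"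
    for u A
  proof -
    obtain \<omega> where \<omega>: "decreases_to_zero \<omega>"
      and le_\<omega>: "\<And>h. h \<in> A \<Longrightarrow> norm (jY (k u h)) \<le> \<omega> (norm (jX h))"
    proof (rule modulus_exists)
      show "\<exists>d>0. \<forall>h\<in>A. norm (jX h) < d \<longrightarrow> norm (jY (k u h)) < e" if "e > 0" for e
        using cont[OF u that] A by blast
    qed (use bdd in auto)
    obtain L1 where "L1 \<ge> 0" and L1: "\<And>h k d e. has_dir_deriv F1 u h d \<Longrightarrow>
        has_dir_deriv F1 u k e \<Longrightarrow> norm (d - e) \<le> L1 * norm (h - k)"
      using has_dir_deriv_lipschitz[OF assms(3,1) u] by blast
    obtain L2 where "L2 \<ge> 0" and L2: "\<And>h k d e. has_dir_deriv F2 (F1 u) h d \<Longrightarrow>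
        has_dir_deriv F2 (F1 u) k e \<Longrightarrow> norm (d - e) \<le> L2 * norm (h - k)"
      using has_dir_deriv_lipschitz[OF assms(4,2) V[OF u]] by blast
    note r1 = assms(10)[OF u] and r2 = assms(11)[OF V[OF u]]
    \<comment> \<open>The first two summands come from the remainder of \<open>F2\<close>, where the
      norm of \<open>k u h\<close> is at most \<open>L1 + \<rho>1 u \<delta>\<close> times that of
      \<open>h\<close>; the third is the error from replacing \<open>k u h\<close> by the derivative
      of \<open>F1\<close>. The product is expanded because \<open>L1 + \<rho>1 u \<delta>\<close>
      itself need not tend to 0.\<close>
    define \<rho> where "\<rho> \<delta> = L1 * \<rho>2 (F1 u) (\<omega> \<delta>) + \<rho>2 (F1 u) (\<omega> \<delta>) * \<rho>1 u \<delta> + L2 * \<rho>1 u \<delta>" for \<delta>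
    note r2\<omega> = decreases_to_zero_compose[OF r2 \<omega>]
    have "decreases_to_zero \<rho>"
      unfolding \<rho>_def
      by (rule decreases_to_zero_add[OF decreases_to_zero_add
            [OF decreases_to_zero_cmult[OF r2\<omega> \<open>L1 \<ge> 0\<close>] decreases_to_zero_mult[OF r2\<omega> r1]]
            decreases_to_zero_cmult[OF r1 \<open>L2 \<ge> 0\<close>]])
    moreover have "norm (R u h) \<le> \<rho> (norm (jX h)) * norm h" if h: "h \<in> A" for h
    proof -
      let ?d = "dir_deriv F1 u h" and ?v = "F1 u" and ?\<delta> = "norm (jX h)"
      have rem1: "norm (k u h - ?d) \<le> \<rho>1 u ?\<delta> * norm h"
        unfolding k_def by (rule assms(12)[OF u A[OF h]])
      \<comment> \<open>The derivative in direction 0 is 0, so the Lipschitz bound against it is a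
        growth bound.\<close>
      have "norm ?d \<le> L1 * norm h"
        using L1[OF bouligand_has_dir_deriv[OF D1[OF u]] has_dir_deriv_zero] by simp
      then have k: "norm (k u h) \<le> (L1 + \<rho>1 u ?\<delta>) * norm h"
        using rem1 norm_triangle_sub[of "k u h" ?d] by (simp add: algebra_simps)
      have vk: "?v + k u h = F1 (u + h)" by (simp add: k_def)
      have "norm (F2 (?v + k u h) - F2 ?v - dir_deriv F2 ?v (k u h))
          \<le> \<rho>2 ?v (norm (jY (k u h))) * norm (k u h)"
        by (rule assms(13)) (use vk V A h u in auto)
      also have "\<dots> \<le> \<rho>2 ?v (\<omega> ?\<delta>) * ((L1 + \<rho>1 u ?\<delta>) * norm h)"
        by (intro mult_mono k decreases_to_zero_mono[OF r2] le_\<omega> h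
            decreases_to_zero_nonneg[OF r2] decreases_to_zero_nonneg[OF \<omega>] norm_ge_zero)
      finally have rem2: "norm (F2 (?v + k u h) - F2 ?v - dir_deriv F2 ?v (k u h))
          \<le> \<rho>2 ?v (\<omega> ?\<delta>) * ((L1 + \<rho>1 u ?\<delta>) * norm h)" .
      \<comment> \<open>The directional derivative need not be additive in the direction; its
        Lipschitz bound replaces linearity here.\<close>
      have "norm (dir_deriv F2 ?v (k u h) - dir_deriv F2 ?v ?d) \<le> L2 * norm (k u h - ?d)"
        by (intro L2 bouligand_has_dir_deriv D2 V u)
      also have "\<dots> \<le> L2 * (\<rho>1 u ?\<delta> * norm h)"
        using rem1 \<open>L2 \<ge> 0\<close> by (rule mult_left_mono)
      finally have diff: "norm (dir_deriv F2 ?v (k u h) - dir_deriv F2 ?v ?d)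
          \<le> L2 * (\<rho>1 u ?\<delta> * norm h)" .
      have "R u h = (F2 (?v + k u h) - F2 ?v - dir_deriv F2 ?v (k u h))
          + (dir_deriv F2 ?v (k u h) - dir_deriv F2 ?v ?d)"
        by (simp add: R_def B_def vk)
      then have "norm (R u h) \<le> \<rho>2 ?v (\<omega> ?\<delta>) * ((L1 + \<rho>1 u ?\<delta>) * norm h)
          + L2 * (\<rho>1 u ?\<delta> * norm h)"
        using norm_triangle_mono[OF rem2 diff] by simp
      then show ?thesis by (simp add: \<rho>_def algebra_simps)
    qed
    ultimately show ?thesis by blast
  qed

  have loc: "\<exists>\<rho> r. decreases_to_zero \<rho> \<and> r > 0 \<and>
      (\<forall>h. u + h \<in> U \<longrightarrow> norm (jX h) < r \<longrightarrow> norm (R u h) \<le> \<rho> (norm (jX h)) * norm h)"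
    if u: "u \<in> U" for u
  proof -
    \<comment> \<open>The tolerance 1 is arbitrary: any fixed bound on the weak norms of
      \<open>k u h\<close> makes the modulus finite.\<close>
    obtain r where "r > 0"
      and r: "\<And>h. u + h \<in> U \<Longrightarrow> norm (jX h) < r \<Longrightarrow> norm (jY (k u h)) < 1"
      using cont[OF u, of 1] by auto
    have "\<exists>\<rho>. decreases_to_zero \<rho> \<and>
        (\<forall>h\<in>{h. u + h \<in> U \<and> norm (jX h) < r}. norm (R u h) \<le> \<rho> (norm (jX h)) * norm h)"
      by (rule core[OF u]) (auto intro!: bdd_aboveI[of _ 1] less_imp_le r)
    then show ?thesis using \<open>r > 0\<close> by blast
  qed

  have glob: "\<exists>\<rho>. decreases_to_zero \<rho> \<and>
      (\<forall>h. u + h \<in> U \<longrightarrow> norm (R u h) \<le> \<rho> (norm (jX h)) * norm h)"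
    if u: "u \<in> U" and bd: "\<forall>S\<subseteq>U. bounded (jX ` S) \<longrightarrow> bounded (jY ` F1 ` S)" for u
  proof -
    have "bdd_above ((\<lambda>h. norm (jY (k u h))) ` {h \<in> {h. u + h \<in> U}. norm (jX h) \<le> D})" for D
    proof -
      \<comment> \<open>These are the points \<open>u + h\<close> of \<open>U\<close> whose
        increments have weak norm at most \<open>D\<close>. Centring both bounded images at the
        images of \<open>u\<close> converts boundedness into bounds on increments.\<close>
      let ?S = "{x \<in> U. norm (jX (x - u)) \<le> D}"
      have "bounded (jX ` ?S)"
        by (auto simp: bounded_any_center[of _ "jX u"] dist_norm norm_minus_commute jX.diff)
      then have "bounded (jY ` F1 ` ?S)" using bd[rule_format, of ?S] by auto
      then obtain M where "\<forall>y \<in> jY ` F1 ` ?S. dist (jY (F1 u)) y \<le> M"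
        unfolding bounded_any_center[of _ "jY (F1 u)"] by (elim exE)
      then have M: "norm (jY (k u h)) \<le> M" if "u + h \<in> U" "norm (jX h) \<le> D" for h
        using that by (auto simp: dist_norm norm_minus_commute[of "jY (F1 u)"] k_def jY.diff)
      show ?thesis
        by (rule bdd_aboveI[of _ M]) (use M in auto)
    qed
    then show ?thesis using core[OF u, of "{h. u + h \<in> U}"] by auto
  qed

  have lim: "((\<lambda>h. norm (R u h) / norm h) \<longlongrightarrow> 0) (at 0)" if u: "u \<in> U" for u
  proof -
    obtain \<rho> r where \<rho>: "decreases_to_zero \<rho>" and "r > 0"
      and R: "\<And>h. u + h \<in> U \<Longrightarrow> norm (jX h) < r \<Longrightarrow> norm (R u h) \<le> \<rho> (norm (jX h)) * norm h"
      using loc[OF u] by blast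
    have jX0: "((\<lambda>h. norm (jX h)) \<longlongrightarrow> 0) (at 0)"
      by (auto intro!: tendsto_eq_intros jX.tendsto simp: jX.zero)
    \<comment> \<open>The limit of \<open>\<rho>\<close> is one-sided and omits 0, so the weak norm
      must stay positive as it tends to 0; continuity of \<open>jX\<close> alone does not give
      this.\<close>
    have "jX h \<noteq> 0" if "h \<noteq> 0" for h
      using injD[OF inj, of h 0] that by (auto simp: jX.zero)
    with jX0 have "filterlim (\<lambda>h. norm (jX h)) (at_right 0) (at 0)"
      unfolding filterlim_at by (auto simp: eventually_at_filter)
    then have "((\<lambda>h. \<rho> (norm (jX h))) \<longlongrightarrow> 0) (at 0)"
      by (rule filterlim_compose[OF decreases_to_zero_tendsto[OF \<rho>]])
    moreover have "\<forall>\<^sub>F h in at 0. norm (norm (R u h) / norm h) \<le> \<rho> (norm (jX h))"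
    proof -
      have "\<forall>\<^sub>F h in at 0. u + h \<in> U"
        by (rule topological_tendstoD[OF _ assms(1) u]) (auto intro!: tendsto_eq_intros)
      moreover have "\<forall>\<^sub>F h in at 0. norm (jX h) < r"
        by (rule order_tendstoD(2)[OF jX0 \<open>r > 0\<close>])
      moreover have "\<forall>\<^sub>F h in at (0::'x). h \<noteq> 0" by (simp add: eventually_at_filter)
      ultimately show ?thesis
        by eventually_elim (use R in \<open>simp add: divide_le_eq\<close>)
    qed
    ultimately show ?thesis by (rule Lim_null_comparison[rotated])
  qed
  \<comment> \<open>Positive homogeneity survives composition, so with \<open>lim\<close> the
    candidate \<open>B u\<close> meets both conditions that identify it as the derivative.\<close>
  have hom: "B u (c *\<^sub>R h) = c *\<^sub>R B u h" if "u \<in> U" "c \<ge> 0" for u c h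
    using that by (simp add: B_def dir_deriv_scale D1 D2 V)

  have "bouligand_differentiable_on (F2 \<circ> F1) U"
    unfolding bouligand_differentiable_on_def
    using bouligand_differentiable_atI[OF hom lim[unfolded R_def]] by blast
  moreover have "\<forall>u\<in>U. \<forall>h. dir_deriv (F2 \<circ> F1) u h = B u h"
    using dir_deriv_eq_homogeneous[OF hom lim[unfolded R_def]] by blast
  ultimately show ?thesis
    using loc glob unfolding R_def B_def by (intro conjI ballI impI) simp_all
qed

end
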